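(* Let $\succ_0$ and $\succ$ be preference relations over the same relation schema that are both weak orders (WOs). Then the preference relation $\succ_0\otimes\succ$ is a strict partial order (SPO).
   Context: A relation schema $R(A_1,\dots,A_k)$ assigns each attribute $A_i$ a domain $U_i$, either a countably infinite set $D$ of uninterpreted constants or the set $\mathbb{Q}$ of rational numbers; tuples are elements of $U=U_1\times\cdots\times U_k$. A preference relation over $R$ is any subset of $U\times U$ (possibly infinite). A preference relation $\succ$ is an SPO if it is irreflexive and transitive; it is a WO if it is an SPO and negatively transitive: for all $x,y,z$, $(x\not\succ y\wedge y\not\succ z)$ implies $x\not\succ z$. Pareto composition: $t_1(\succ_0\otimes\succ)t_2$ iff $(t_1\succ_0 t_2\wedge t_2\not\succ t_1)\vee(t_1\succ t_2\wedge t_2\not\succ_0 t_1)$. *)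

theory Defs
  imports Complex_Main "HOL-Library.Countable_Set"
begin

datatype attr_type = Uninterpreted | Rational

datatype 'd val = Const 'd | Num rat

text \<open>
  A relation schema is the list of its attribute names, each with its type. The set \<open>D\<close> of
  uninterpreted constants is a parameter; it is assumed countably infinite wherever it is used.
\<close>

type_synonym 'a schema = "('a \<times> attr_type) list"

definition relation_schema :: "'a schema \<Rightarrow> bool" where
  "relation_schema R \<longleftrightarrow> distinct (map fst R)"

fun attr_domain :: "'d set \<Rightarrow> attr_type \<Rightarrow> 'd val set" where
  "attr_domain D Uninterpreted = Const ` D"
| "attr_domain D Rational = range Num"

text \<open>The product \<open>U\<^sub>1 \<times> \<dots> \<times> U\<^sub>k\<close>, with tuples represented as lists of length \<open>k\<close>.\<close>

definition tuples :: "'d set \<Rightarrow> 'a schema \<Rightarrow> 'd val list set" where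
  "tuples D R = listset (map (\<lambda>(A, T). attr_domain D T) R)"

definition preference_relation :: "'t set \<Rightarrow> 't rel \<Rightarrow> bool" where
  "preference_relation U P \<longleftrightarrow> P \<subseteq> U \<times> U"

definition negatively_trans_on :: "'t set \<Rightarrow> 't rel \<Rightarrow> bool" where
  "negatively_trans_on U P \<longleftrightarrow>
     (\<forall>x\<in>U. \<forall>y\<in>U. \<forall>z\<in>U. (x, y) \<notin> P \<and> (y, z) \<notin> P \<longrightarrow> (x, z) \<notin> P)"

definition SPO :: "'t set \<Rightarrow> 't rel \<Rightarrow> bool" where
  "SPO U P \<longleftrightarrow> preference_relation U P \<and> irrefl_on U P \<and> trans_on U P"

definition WO :: "'t set \<Rightarrow> 't rel \<Rightarrow> bool" where
  "WO U P \<longleftrightarrow> SPO U P \<and> negatively_trans_on U P"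

definition pareto :: "'t rel \<Rightarrow> 't rel \<Rightarrow> 't rel" where
  "pareto P\<^sub>0 P = {(t\<^sub>1, t\<^sub>2). ((t\<^sub>1, t\<^sub>2) \<in> P\<^sub>0 \<and> (t\<^sub>2, t\<^sub>1) \<notin> P) \<or> ((t\<^sub>1, t\<^sub>2) \<in> P \<and> (t\<^sub>2, t\<^sub>1) \<notin> P\<^sub>0)}"

end

theory Submission
  imports Defs
begin

text \<open>
  In a weak order, \<open>(y, x) \<notin> P\<close> is a total preorder ``\<open>x\<close> is at least as good as \<open>y\<close>''. A tuple
  Pareto-dominates another iff it is at least as good in both orders and strictly better in one of
  them; negative transitivity propagates both conditions along a chain.
\<close>

lemma WO_asym:
  assumes "WO U P" and "(x, y) \<in> P"
  shows "(y, x) \<notin> P"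
  using assms unfolding WO_def SPO_def preference_relation_def irrefl_on_def trans_on_def by blast

text \<open>Contrapositive form: a strict preference can be split at any intermediate tuple
  \<open>y\<close> of \<open>U\<close>.\<close>

lemma WO_negatively_trans:
  assumes "WO U P" and "x \<in> U" and "y \<in> U" and "z \<in> U" and "(x, z) \<in> P"
  shows "(x, y) \<in> P \<or> (y, z) \<in> P"
  using assms unfolding WO_def negatively_trans_on_def by blast

text \<open>By asymmetry, strictness in one order already excludes the reverse pair there, so both
  disjuncts of \<open>pareto\<close> share the same two negative conditions.\<close>

lemma pareto_iff:
  assumes "WO U P\<^sub>0" and "WO U P"
  shows "(x, y) \<in> pareto P\<^sub>0 P \<longleftrightarrow>
    (y, x) \<notin> P\<^sub>0 \<and> (y, x) \<notin> P \<and> ((x, y) \<in> P\<^sub>0 \<or> (x, y) \<in> P)"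
  using WO_asym[OF assms(1)] WO_asym[OF assms(2)] unfolding pareto_def by blast

lemma SPO_pareto:
  assumes "WO U P\<^sub>0" and "WO U P"
  shows "SPO U (pareto P\<^sub>0 P)"
  unfolding SPO_def
proof (intro conjI)
  show "preference_relation U (pareto P\<^sub>0 P)"
    using assms unfolding WO_def SPO_def preference_relation_def pareto_def by blast
  show "irrefl_on U (pareto P\<^sub>0 P)"
    unfolding irrefl_on_def pareto_iff[OF assms] by blast
  show "trans_on U (pareto P\<^sub>0 P)"
  proof (rule trans_onI)
    fix x y z
    assume U: "x \<in> U" "y \<in> U" "z \<in> U"
      and "(x, y) \<in> pareto P\<^sub>0 P" and "(y, z) \<in> pareto P\<^sub>0 P"
    \<comment> \<open>Splitting \<open>(z, x)\<close> at \<open>y\<close> contradicts a negative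
      condition in either order. Splitting the strict pair \<open>(x, y)\<close> at \<open>z\<close>
      leaves \<open>(x, z)\<close>, since \<open>(z, y)\<close> is excluded.\<close>
    then show "(x, z) \<in> pareto P\<^sub>0 P"
      unfolding pareto_iff[OF assms]
      using WO_negatively_trans[OF assms(1)] WO_negatively_trans[OF assms(2)] by metis
  qed
qed

theorem theorem4:
  fixes D :: "'d set" and R :: "'a schema" and P\<^sub>0 P :: "'d val list rel"
  assumes "countable D" and "infinite D"
    and "relation_schema R"
    and "preference_relation (tuples D R) P\<^sub>0" and "preference_relation (tuples D R) P"
    and "WO (tuples D R) P\<^sub>0" and "WO (tuples D R) P"
  shows "SPO (tuples D R) (pareto P\<^sub>0 P)"
  using assms(6,7) by (rule SPO_pareto)

end
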